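(* Assume that $\varphi$ has accuracy $\kappa$ and that the translates $\{\varphi(\cdot-k)\}_{k\in\Gamma}$ are linearly independent. Let $\lambda_1,\dots,\lambda_d$ be the eigenvalues of $A$ (counted with multiplicity) and let $\eta=\left(\frac1{\lambda_1},\dots,\frac1{\lambda_d}\right)$. Then for every $n\ge0$, every $s\in\{0,1,\dots,\kappa-1\}$ and every multi-index $\alpha$ with $|\alpha|=s$, the number $\eta^\alpha$ is an eigenvalue of $T_n$.
   Context: $\Gamma\subset\mathbb{R}^d$ is a lattice (the image of $\mathbb{Z}^d$ under a nonsingular linear map) and $A$ is a dilation matrix associated to $\Gamma$: a $d\times d$ real matrix with $A(\Gamma)\subset\Gamma$ all of whose eigenvalues have modulus $>1$. $\Lambda\subset\Gamma$ is finite and nonempty, $c_k\in\mathbb{C}$ for $k\in\Lambda$, $c_k=0$ for $k\in\Gamma\setminus\Lambda$. $\varphi:\mathbb{R}^d\to\mathbb{C}$ is a compactly supported function satisfying $\varphi(x)=\sum_{k\in\Lambda}c_k\varphi(Ax-k)$ for $x\in\mathbb{R}^d$. $\ell(\Gamma)$ is the space of all complex sequences $\{y_k\}_{k\in\Gamma}$. $\mathcal{S}(\varphi)$ is the set of all functions $f(x)=\sum_{k\in\Gamma}y_k\varphi(x+k)$, $\{y_k\}\in\ell(\Gamma)$. The translates are linearly independent if $\sum_{k\in\Gamma}\alpha_k\varphi(\cdot-k)\equiv0$ with $\{\alpha_k\}\in\ell(\Gamma)$ implies all $\alpha_k=0$. The accuracy of $\varphi$ is the largest integer $\kappa$ such that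 all multivariate polynomials $q$ with $\deg(q)<\kappa$ are in $\mathcal{S}(\varphi)$. Multi-index notation: $\alpha=(\alpha_1,\dots,\alpha_d)$ with nonnegative integer entries, $|\alpha|=\alpha_1+\cdots+\alpha_d$, $\eta^\alpha=\eta_1^{\alpha_1}\cdots\eta_d^{\alpha_d}$. For a finite nonempty $H\subset\Gamma$ and $B\subset\mathbb{R}^d$ let $w_H(B)=A^{-1}(B+H)$; $K_H$ is the unique nonempty compact set with $w_H(K_H)=K_H$, and $\Omega_H=K_H\cap\Gamma$. A set $\Omega\subset\Gamma$ is $H$-admissible if $w_H(\Omega)\cap\Gamma\subset\Omega$. $D\subset\Gamma$ is a full set of representatives of $\Gamma/A(\Gamma)$ with $0\in D$, such that the translates $K_D+k$, $k\in\Gamma$, of $Q=K_D$ cover $\mathbb{R}^d$ with overlaps of measure zero. $\Lambda'=\Lambda-D$ and $\Omega'=K_{\Lambda'}\cap\Gamma$. $\{\Omega_n\}_{n\ge0}$ is a fixed sequence of finite subsets of $\Gamma$ such that: $\Omega_0=\Omega_\Lambda$; $\Omega_i\subsetneq\Omega_{i+1}$ for all $i\ge 0$ and $\bigcup_i\Omega_i=\Gamma$; each $\Omega_i$ is $\Lambda$-admissible and $w_\Lambda(\Omega_{i+1})\cap\Gamma\subset\Omega_i$ for all $i\ge 0$; $\Omega_{n_0}=\Omega'$ for some index $n_0$; and for $i\ge n_0$, $\Omega_i$ is $\Lambda'$-admissible and $w_{\Lambda'}(\Omega_{i+1})\cap\Gamma\subset\Omega_i$. $T_n=[c_{Ai-j}]_{i,j\in\Omega_n}$.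 *)

theory Defs
  imports "HOL-Analysis.Analysis" "HOL-Computational_Algebra.Polynomial"
begin

section \<open>Eigenvalues\<close>

text \<open>
  Square matrices indexed by a finite set \<open>I\<close> are functions \<open>M\<close> of two arguments,
  of which only the values on \<open>I \<times> I\<close> matter.
\<close>

definition eigenvalue_on :: "'i set \<Rightarrow> ('i \<Rightarrow> 'i \<Rightarrow> complex) \<Rightarrow> complex \<Rightarrow> bool" where
  "eigenvalue_on I M \<mu> \<longleftrightarrow>
     (\<exists>v. (\<exists>i\<in>I. v i \<noteq> 0) \<and> (\<forall>i\<in>I. (\<Sum>j\<in>I. M i j * v j) = \<mu> * v i))"

definition complex_char_poly :: "real^'n^'n \<Rightarrow> complex poly" where
  "complex_char_poly A =
     det (\<chi> i j. (if i = j then [:0, 1:] else 0) - [:complex_of_real (A $ i $ j):])"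

text \<open>The family \<open>ev\<close> enumerates the complex eigenvalues with their algebraic multiplicity.\<close>

definition eigenvalues_with_multiplicity :: "real^'n^'n \<Rightarrow> ('n \<Rightarrow> complex) \<Rightarrow> bool" where
  "eigenvalues_with_multiplicity A ev \<longleftrightarrow> complex_char_poly A = (\<Prod>i\<in>UNIV. [:- ev i, 1:])"


section \<open>Lattices and dilation matrices\<close>

definition is_lattice :: "(real^'n) set \<Rightarrow> bool" where
  "is_lattice \<Gamma> \<longleftrightarrow>
     (\<exists>M :: real^'n^'n. invertible M \<and> \<Gamma> = (\<lambda>z. M *v z) ` {z. \<forall>i. z $ i \<in> \<int>})"

definition dilation_matrix :: "(real^'n) set \<Rightarrow> real^'n^'n \<Rightarrow> bool" where
  "dilation_matrix \<Gamma> A \<longleftrightarrow>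
     (\<lambda>x. A *v x) ` \<Gamma> \<subseteq> \<Gamma> \<and>
     (\<forall>z. eigenvalue_on UNIV (\<lambda>i j. complex_of_real (A $ i $ j)) z \<longrightarrow> cmod z > 1)"

definition full_representatives :: "(real^'n) set \<Rightarrow> real^'n^'n \<Rightarrow> (real^'n) set \<Rightarrow> bool" where
  "full_representatives \<Gamma> A D \<longleftrightarrow>
     D \<subseteq> \<Gamma> \<and> (\<forall>k\<in>\<Gamma>. \<exists>!d. d \<in> D \<and> k - d \<in> (\<lambda>x. A *v x) ` \<Gamma>)"

definition tiles_by :: "(real^'n) set \<Rightarrow> (real^'n) set \<Rightarrow> bool" where
  "tiles_by \<Gamma> Q \<longleftrightarrow>
     (\<Union>k\<in>\<Gamma>. (\<lambda>x. x + k) ` Q) = UNIV \<and>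
     (\<forall>k\<in>\<Gamma>. \<forall>l\<in>\<Gamma>. k \<noteq> l \<longrightarrow> negligible ((\<lambda>x. x + k) ` Q \<inter> (\<lambda>x. x + l) ` Q))"


section \<open>Attractors and admissible sets\<close>

definition w_map :: "real^'n^'n \<Rightarrow> (real^'n) set \<Rightarrow> (real^'n) set \<Rightarrow> (real^'n) set" where
  "w_map A H B = {matrix_inv A *v (b + h) | b h. b \<in> B \<and> h \<in> H}"

text \<open>
  For a dilation matrix \<open>A\<close> and a finite nonempty \<open>H\<close> the set described here exists
  and is unique, by Hutchinson's theorem.
\<close>

definition attractor :: "real^'n^'n \<Rightarrow> (real^'n) set \<Rightarrow> (real^'n) set" where
  "attractor A H = (THE K. K \<noteq> {} \<and> compact K \<and> w_map A H K = K)"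

definition lattice_attractor ::
    "(real^'n) set \<Rightarrow> real^'n^'n \<Rightarrow> (real^'n) set \<Rightarrow> (real^'n) set" where
  "lattice_attractor \<Gamma> A H = attractor A H \<inter> \<Gamma>"

definition admissible ::
    "(real^'n) set \<Rightarrow> real^'n^'n \<Rightarrow> (real^'n) set \<Rightarrow> (real^'n) set \<Rightarrow> bool" where
  "admissible \<Gamma> A H \<Omega> \<longleftrightarrow> \<Omega> \<subseteq> \<Gamma> \<and> w_map A H \<Omega> \<inter> \<Gamma> \<subseteq> \<Omega>"

definition minkowski_diff :: "(real^'n) set \<Rightarrow> (real^'n) set \<Rightarrow> (real^'n) set" where
  "minkowski_diff S T = {s - t | s t. s \<in> S \<and> t \<in> T}"


section \<open>Refinable functions and accuracy\<close>

definition compactly_supported :: "(real^'n \<Rightarrow> complex) \<Rightarrow> bool" where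
  "compactly_supported \<phi> \<longleftrightarrow> compact (closure {x. \<phi> x \<noteq> 0})"

definition refinable ::
    "real^'n^'n \<Rightarrow> (real^'n) set \<Rightarrow> (real^'n \<Rightarrow> complex) \<Rightarrow> (real^'n \<Rightarrow> complex) \<Rightarrow> bool" where
  "refinable A \<Lambda> c \<phi> \<longleftrightarrow> (\<forall>x. \<phi> x = (\<Sum>k\<in>\<Lambda>. c k * \<phi> (A *v x - k)))"

text \<open>
  Sequences indexed by \<open>\<Gamma>\<close> are functions on the whole space whose values outside \<open>\<Gamma>\<close>
  are ignored. For compactly supported \<open>\<phi>\<close> only finitely many terms of the sums over
  \<open>\<Gamma>\<close> below are nonzero at each point \<open>x\<close>, so that \<open>has_sum\<close> denotes a finite sum.
\<close>

definition shift_space ::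
    "(real^'n) set \<Rightarrow> (real^'n \<Rightarrow> complex) \<Rightarrow> (real^'n \<Rightarrow> complex) set" where
  "shift_space \<Gamma> \<phi> = {f. \<exists>y. \<forall>x. ((\<lambda>k. y k * \<phi> (x + k)) has_sum f x) \<Gamma>}"

definition independent_translates :: "(real^'n) set \<Rightarrow> (real^'n \<Rightarrow> complex) \<Rightarrow> bool" where
  "independent_translates \<Gamma> \<phi> \<longleftrightarrow>
     (\<forall>a. (\<forall>x. ((\<lambda>k. a k * \<phi> (x - k)) has_sum 0) \<Gamma>) \<longrightarrow> (\<forall>k\<in>\<Gamma>. a k = 0))"

definition multi_degree :: "('n::finite \<Rightarrow> nat) \<Rightarrow> nat" where
  "multi_degree \<alpha> = (\<Sum>i\<in>UNIV. \<alpha> i)"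

definition multi_power :: "('n::finite \<Rightarrow> complex) \<Rightarrow> ('n \<Rightarrow> nat) \<Rightarrow> complex" where
  "multi_power u \<alpha> = (\<Prod>i\<in>UNIV. u i ^ \<alpha> i)"

text \<open>Polynomial functions with complex coefficients; for \<open>m = 0\<close> only the zero function remains.\<close>

definition polys_of_degree_less :: "nat \<Rightarrow> (real^'n \<Rightarrow> complex) set" where
  "polys_of_degree_less m =
     {q. \<exists>a. \<forall>x. q x =
        (\<Sum>\<alpha> | multi_degree \<alpha> < m. a \<alpha> * multi_power (\<lambda>i. complex_of_real (x $ i)) \<alpha>)}"

definition has_accuracy :: "(real^'n) set \<Rightarrow> (real^'n \<Rightarrow> complex) \<Rightarrow> nat \<Rightarrow> bool" where
  "has_accuracy \<Gamma> \<phi> \<kappa> \<longleftrightarrow>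
     polys_of_degree_less \<kappa> \<subseteq> shift_space \<Gamma> \<phi> \<and>
     (\<forall>m. polys_of_degree_less m \<subseteq> shift_space \<Gamma> \<phi> \<longrightarrow> m \<le> \<kappa>)"

end

theory Submission
  imports Defs
begin

text \<open>
  A polynomial eigenfunction of the dilation yields a left eigenvector of the infinite matrix
  \<open>T = [c (A i - j)]\<close> over \<open>\<Gamma>\<close>, and admissibility lets that eigenvector be cut down to \<open>\<Omega> n\<close>.

  The polynomial: choose for every index \<open>i\<close> a left eigenvector \<open>u i\<close> of \<open>A\<close> for \<open>ev i\<close>. Then
  \<open>f x = (\<Prod>i. (u i \<cdot> x) ^ \<alpha> i)\<close> satisfies \<open>f (A x) = ev\<^sup>\<alpha> f x\<close>. The vectors \<open>u i\<close> may
  repeat when an eigenvalue is repeated, so a defective \<open>A\<close> causes no difficulty; \<open>f\<close> is not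
  the zero function because each \<open>u i \<cdot> x\<close> vanishes only on a null set
  (\<open>polynomial_eigenfunction_exists\<close>).

  The eigensequence: as \<open>f\<close> has degree less than the accuracy, \<open>f x = (\<Sum>k. y k * \<phi> (x + k))\<close>
  for some \<open>y\<close>. Substituting the refinement equation gives \<open>f x = (\<Sum>m. (y T) m * \<phi> (A x + m))\<close>,
  where \<open>y\<close> is read as a row vector (\<open>has_sum_subdivision\<close>). Comparison with the expansion of
  \<open>f (A x)\<close> and linear independence of the translates give \<open>y = ev\<^sup>\<alpha> (y T)\<close>
  (\<open>subdivision_eigensequence\<close>).

  The restriction: for \<open>j\<close> in an admissible set \<open>\<Omega>\<close> every nonzero entry \<open>c (A i - j)\<close> of column
  \<open>j\<close> has its row index \<open>i\<close> in \<open>\<Omega>\<close>. Hence \<open>y\<close> restricted to \<open>\<Omega> n\<close> is a left eigenvector of the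
  finite matrix, provided it is not zero there. If \<open>y\<close> vanished on \<open>\<Omega> 0\<close>, it would vanish on
  \<open>\<Omega> 1\<close>, \<open>\<Omega> 2\<close>, \<dots>, since column \<open>j \<in> \<Omega> (Suc i)\<close> has its nonzero entries in rows of \<open>\<Omega> i\<close>;
  then \<open>y\<close> and \<open>f\<close> would be zero (\<open>eigensequence_nonzero_on_first\<close>). A left eigenvalue of a
  finite matrix is also a right eigenvalue.
\<close>

section \<open>Left and right eigenvectors\<close>

text \<open>
  One step of Gaussian elimination: a nonzero entry \<open>M i p\<close> expresses the unknown \<open>p\<close> by the
  others, which removes one equation and one unknown at a time.
\<close>

lemma underdetermined_system_solvable:
  fixes M :: "'i \<Rightarrow> 'j \<Rightarrow> complex"
  assumes "finite I" "finite J" "card I < card J"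
  shows "\<exists>v. (\<exists>j\<in>J. v j \<noteq> 0) \<and> (\<forall>i\<in>I. (\<Sum>j\<in>J. M i j * v j) = 0)"
  using assms
proof (induction I arbitrary: J M rule: finite_induct)
  case empty
  then have "J \<noteq> {}" by auto
  then show ?case by (intro exI[of _ "\<lambda>_. 1"]) auto
next
  case (insert i I)
  show ?case
  proof (cases "\<forall>j\<in>J. M i j = 0")
    case True
    obtain v where "\<exists>j\<in>J. v j \<noteq> 0" "\<forall>i\<in>I. (\<Sum>j\<in>J. M i j * v j) = 0"
      using insert.IH[of J M] insert.prems insert.hyps by auto
    then show ?thesis using True by (intro exI[of _ v]) auto
  next
    case False
    then obtain p where p: "p \<in> J" "M i p \<noteq> 0" by blast
    define J' where "J' = J - {p}"
    have J: "finite J'" "p \<notin> J'" "J = insert p J'" using p insert.prems by (auto simp: J'_def)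
    \<comment> \<open>Row \<open>k\<close> after subtracting the multiple of row \<open>i\<close> that cancels column \<open>p\<close>.\<close>
    define M' where "M' k j = M k j - M k p * M i j / M i p" for k j
    obtain v where v: "\<exists>j\<in>J'. v j \<noteq> 0" "\<forall>k\<in>I. (\<Sum>j\<in>J'. M' k j * v j) = 0"
      using insert.IH[of J' M'] insert.prems insert.hyps J by auto
    define t where "t = - (\<Sum>j\<in>J'. M i j * v j) / M i p"
    define w where "w = v(p := t)"
    have sum_w: "(\<Sum>j\<in>J. M k j * w j) = M k p * t + (\<Sum>j\<in>J'. M k j * v j)" for k
    proof -
      have "(\<Sum>j\<in>J'. M k j * w j) = (\<Sum>j\<in>J'. M k j * v j)"
        using J by (intro sum.cong) (auto simp: w_def)
      then show ?thesis using J by (simp add: w_def)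
    qed
    have "(\<Sum>j\<in>J. M k j * w j) = 0" if "k \<in> insert i I" for k
    proof (cases "k = i")
      case True
      then show ?thesis using p by (simp add: sum_w t_def)
    next
      case False
      have "0 = (\<Sum>j\<in>J'. M' k j * v j)" using v False that by auto
      also have "\<dots> = (\<Sum>j\<in>J'. M k j * v j) - M k p / M i p * (\<Sum>j\<in>J'. M i j * v j)"
        by (simp add: M'_def sum_subtractf sum_distrib_left algebra_simps)
      finally show ?thesis by (simp add: sum_w t_def)
    qed
    moreover have "\<exists>j\<in>J. w j \<noteq> 0" using v J by (auto simp: w_def)
    ultimately show ?thesis by blast
  qed
qed

text \<open>
  A left null vector \<open>y\<close> with \<open>y p \<noteq> 0\<close> makes row \<open>p\<close> a combination of the other rows.
  Without that row there are fewer equations than unknowns, and every solution of the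
  smaller system solves the full one.
\<close>

lemma singular_if_left_null_vector:
  fixes N :: "'i \<Rightarrow> 'i \<Rightarrow> complex"
  assumes "finite I" "p \<in> I" "y p \<noteq> 0" and null: "\<And>j. j \<in> I \<Longrightarrow> (\<Sum>i\<in>I. y i * N i j) = 0"
  shows "\<exists>v. (\<exists>j\<in>I. v j \<noteq> 0) \<and> (\<forall>i\<in>I. (\<Sum>j\<in>I. N i j * v j) = 0)"
proof -
  have "card (I - {p}) < card I" using assms by (metis card_Diff1_less)
  then obtain v where v: "\<exists>j\<in>I. v j \<noteq> 0" "\<forall>i\<in>I - {p}. (\<Sum>j\<in>I. N i j * v j) = 0"
    using underdetermined_system_solvable[of "I - {p}" I N] assms(1) by auto
  have "y p * (\<Sum>j\<in>I. N p j * v j) = (\<Sum>i\<in>I. y i * (\<Sum>j\<in>I. N i j * v j))"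
    using assms(1,2) v(2) by (subst sum.remove[of I p]) auto
  also have "\<dots> = (\<Sum>j\<in>I. (\<Sum>i\<in>I. y i * N i j) * v j)"
    unfolding sum_distrib_left sum_distrib_right by (subst sum.swap) (simp add: mult.assoc)
  also have "\<dots> = 0" using null by simp
  finally have "(\<Sum>j\<in>I. N p j * v j) = 0" using assms(3) by simp
  then show ?thesis using v by (intro exI[of _ v]) auto
qed

lemma eigenvalue_on_if_left_eigenvector:
  assumes "finite I" "p \<in> I" "y p \<noteq> 0"
    and left: "\<And>j. j \<in> I \<Longrightarrow> (\<Sum>i\<in>I. y i * M i j) = \<mu> * y j"
  shows "eigenvalue_on I M \<mu>"
proof -
  define N where "N i j = M i j - (if i = j then \<mu> else 0)" for i j
  have "(\<Sum>i\<in>I. y i * N i j) = 0" if "j \<in> I" for j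
  proof -
    have "(\<Sum>i\<in>I. y i * N i j) = (\<Sum>i\<in>I. y i * M i j) - (\<Sum>i\<in>I. if i = j then y j * \<mu> else 0)"
      unfolding sum_subtractf[symmetric] by (intro sum.cong) (auto simp: N_def algebra_simps)
    then show ?thesis using left[OF that] that assms(1) by simp
  qed
  then obtain v where v: "\<exists>j\<in>I. v j \<noteq> 0" "\<forall>i\<in>I. (\<Sum>j\<in>I. N i j * v j) = 0"
    using singular_if_left_null_vector[of I p y N] assms by blast
  have "(\<Sum>j\<in>I. M i j * v j) = \<mu> * v i" if "i \<in> I" for i
  proof -
    have "(\<Sum>j\<in>I. N i j * v j) = (\<Sum>j\<in>I. M i j * v j) - (\<Sum>j\<in>I. if i = j then \<mu> * v i else 0)"
      unfolding sum_subtractf[symmetric] by (intro sum.cong) (auto simp: N_def algebra_simps)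
    then show ?thesis using v(2) that assms(1) by simp
  qed
  then show ?thesis using v(1) unfolding eigenvalue_on_def by blast
qed


section \<open>Eigenvalues of the dilation matrix\<close>

lemma matrix_inv_inverse:
  fixes A :: "real^'n^'n"
  assumes "invertible A"
  shows "A ** matrix_inv A = mat 1 \<and> matrix_inv A ** A = mat 1"
  using someI_ex[OF assms[unfolded invertible_def]] unfolding matrix_inv_def .

lemma matrix_inv_cancel_left:
  fixes A :: "real^'n^'n"
  assumes "invertible A"
  shows "matrix_inv A *v (A *v x) = x"
  using matrix_inv_inverse[OF assms] by (simp add: matrix_vector_mul_assoc)

lemma matrix_inv_cancel_right:
  fixes A :: "real^'n^'n"
  assumes "invertible A"
  shows "A *v (matrix_inv A *v x) = x"
  using matrix_inv_inverse[OF assms] by (simp add: matrix_vector_mul_assoc)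

text \<open>
  A real null vector of \<open>A\<close> would be an eigenvector for \<open>0\<close>, which is not outside the unit disc.
\<close>

lemma dilation_matrix_invertible:
  assumes "dilation_matrix \<Gamma> A"
  shows "invertible A"
proof (rule ccontr)
  assume "\<not> invertible A"
  then obtain x where x: "A *v x = 0" "x \<noteq> 0"
    using matrix_left_invertible_ker[of A] invertible_left_inverse[of A] by blast
  have "(\<Sum>j\<in>UNIV. complex_of_real (A $ i $ j) * complex_of_real (x $ j)) = 0" for i
  proof -
    have "(\<Sum>j\<in>UNIV. complex_of_real (A $ i $ j) * complex_of_real (x $ j))
        = complex_of_real ((A *v x) $ i)"
      by (simp add: matrix_vector_mult_def)
    then show ?thesis using x by simp
  qed
  moreover have "\<exists>i. x $ i \<noteq> 0" using x(2) by (auto simp: vec_eq_iff)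
  ultimately have "eigenvalue_on UNIV (\<lambda>i j. complex_of_real (A $ i $ j)) 0"
    unfolding eigenvalue_on_def by (intro exI[of _ "\<lambda>i. complex_of_real (x $ i)"]) auto
  then show False using assms unfolding dilation_matrix_def by fastforce
qed

lemma poly_complex_char_poly:
  "poly (complex_char_poly A) z = det (\<chi> i j. (if i = j then z else 0) - complex_of_real (A $ i $ j))"
proof -
  have *: "poly (((if i = j then [:0, 1:] else 0) - [:complex_of_real (A $ i $ j):]) :: complex poly) z
      = (if i = j then z else 0) - complex_of_real (A $ i $ j)" for i j by simp
  show ?thesis unfolding complex_char_poly_def det_def
    by (simp add: poly_sum poly_prod * del: poly_diff)
qed

text \<open>
  As a root of the characteristic polynomial, \<open>ev k\<close> makes the transposed characteristic matrix
  singular; its null vectors are the left eigenvectors.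
\<close>

lemma left_eigenvector_exists:
  fixes A :: "real^'n^'n"
  assumes "eigenvalues_with_multiplicity A ev"
  shows "\<exists>u. (\<exists>j. u j \<noteq> 0) \<and> (\<forall>j. (\<Sum>i\<in>UNIV. u i * complex_of_real (A $ i $ j)) = ev k * u j)"
proof -
  define C :: "complex^'n^'n"
    where "C = (\<chi> i j. (if i = j then ev k else 0) - complex_of_real (A $ i $ j))"
  have "poly (complex_char_poly A) (ev k) = 0"
    using assms unfolding eigenvalues_with_multiplicity_def by (auto simp: poly_prod)
  then have "det (transpose C) = 0" by (simp add: poly_complex_char_poly C_def)
  then have "\<not> invertible (transpose C)" by (simp add: invertible_det_nz)
  then obtain x where x: "transpose C *v x = 0" "x \<noteq> 0"
    using matrix_left_invertible_ker[of "transpose C"] invertible_left_inverse[of "transpose C"]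
    by blast
  have "(\<Sum>i\<in>UNIV. x $ i * complex_of_real (A $ i $ j)) = ev k * x $ j" for j
  proof -
    have "0 = (transpose C *v x) $ j" using x by simp
    also have "\<dots> = (\<Sum>i\<in>UNIV. ((if i = j then ev k else 0) - complex_of_real (A $ i $ j)) * x $ i)"
      by (simp add: matrix_vector_mult_def transpose_def C_def)
    also have "\<dots> = (\<Sum>i\<in>UNIV. if i = j then ev k * x $ j else 0)
        - (\<Sum>i\<in>UNIV. x $ i * complex_of_real (A $ i $ j))"
      unfolding sum_subtractf[symmetric] by (intro sum.cong) (auto simp: algebra_simps)
    finally show ?thesis by simp
  qed
  moreover have "\<exists>j. x $ j \<noteq> 0" using x(2) by (auto simp: vec_eq_iff)
  ultimately show ?thesis by (intro exI[of _ "\<lambda>i. x $ i"]) auto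
qed


section \<open>Polynomial eigenfunctions of the dilation\<close>

definition linear_form :: "('n::finite \<Rightarrow> complex) \<Rightarrow> real^'n \<Rightarrow> complex" where
  "linear_form u x = (\<Sum>j\<in>UNIV. u j * complex_of_real (x $ j))"

lemma linear_form_left_eigenvector:
  assumes "\<And>j. (\<Sum>i\<in>UNIV. u i * complex_of_real (A $ i $ j)) = z * u j"
  shows "linear_form u (A *v x) = z * linear_form u x"
proof -
  have "linear_form u (A *v x)
      = (\<Sum>i\<in>UNIV. \<Sum>j\<in>UNIV. u i * complex_of_real (A $ i $ j) * complex_of_real (x $ j))"
    by (simp add: linear_form_def matrix_vector_mult_def sum_distrib_left mult.assoc)
  also have "\<dots> = (\<Sum>j\<in>UNIV. (\<Sum>i\<in>UNIV. u i * complex_of_real (A $ i $ j)) * complex_of_real (x $ j))"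
    by (subst sum.swap) (simp add: sum_distrib_right)
  finally show ?thesis by (simp add: assms linear_form_def sum_distrib_left mult.assoc)
qed

text \<open>
  The coefficients are complex but the points are real: the zero set lies in the hyperplane
  normal to the real or to the imaginary part of \<open>u\<close>, whichever is nonzero.
\<close>

lemma linear_form_zeros_negligible:
  fixes u :: "'n::finite \<Rightarrow> complex"
  assumes "u j \<noteq> 0"
  shows "negligible {x. linear_form u x = 0}"
proof -
  define a b :: "real^'n" where "a = (\<chi> j. Re (u j))" and "b = (\<chi> j. Im (u j))"
  have "a \<noteq> 0 \<or> b \<noteq> 0" using assms by (auto simp: a_def b_def vec_eq_iff complex_eq_iff)
  moreover have "{x. linear_form u x = 0} \<subseteq> {x. a \<bullet> x = 0}" "{x. linear_form u x = 0} \<subseteq> {x. b \<bullet> x = 0}"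
    by (auto simp: linear_form_def a_def b_def inner_vec_def complex_eq_iff)
  ultimately show ?thesis by (metis negligible_hyperplane negligible_subset)
qed

lemma finite_multi_degree_less: "finite {\<alpha> :: 'n::finite \<Rightarrow> nat. multi_degree \<alpha> < m}"
proof (rule finite_subset)
  show "{\<alpha> :: 'n \<Rightarrow> nat. multi_degree \<alpha> < m} \<subseteq> UNIV \<rightarrow>\<^sub>E {..<m}"
  proof
    fix \<alpha> :: "'n \<Rightarrow> nat" assume "\<alpha> \<in> {\<alpha>. multi_degree \<alpha> < m}"
    moreover have "\<alpha> i \<le> multi_degree \<alpha>" for i
      unfolding multi_degree_def by (rule member_le_sum) auto
    ultimately show "\<alpha> \<in> UNIV \<rightarrow>\<^sub>E {..<m}" by (auto intro: le_less_trans)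
  qed
qed (auto intro: finite_PiE)

lemma polys_of_degree_less_mono:
  assumes "m \<le> m'"
  shows "polys_of_degree_less m \<subseteq> polys_of_degree_less m'"
proof
  fix q :: "real^'n \<Rightarrow> complex" assume "q \<in> polys_of_degree_less m"
  then obtain a where a: "\<And>x. q x =
      (\<Sum>\<alpha> | multi_degree \<alpha> < m. a \<alpha> * multi_power (\<lambda>i. complex_of_real (x $ i)) \<alpha>)"
    unfolding polys_of_degree_less_def by blast
  have "q x = (\<Sum>\<alpha> | multi_degree \<alpha> < m'. (if multi_degree \<alpha> < m then a \<alpha> else 0)
      * multi_power (\<lambda>i. complex_of_real (x $ i)) \<alpha>)" for x
    unfolding a using assms by (intro sum.mono_neutral_cong_left finite_multi_degree_less) auto
  then show "q \<in> polys_of_degree_less m'" unfolding polys_of_degree_less_def by (auto intro: exI)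
qed

lemma polys_of_degree_less_sum:
  assumes "finite S" "\<And>s. s \<in> S \<Longrightarrow> q s \<in> polys_of_degree_less m"
  shows "(\<lambda>x. \<Sum>s\<in>S. w s * q s x) \<in> polys_of_degree_less m"
proof -
  have "\<forall>s\<in>S. \<exists>a. \<forall>x. q s x =
      (\<Sum>\<alpha> | multi_degree \<alpha> < m. a \<alpha> * multi_power (\<lambda>i. complex_of_real (x $ i)) \<alpha>)"
    using assms(2) unfolding polys_of_degree_less_def by blast
  then obtain a where a: "\<And>s x. s \<in> S \<Longrightarrow> q s x =
      (\<Sum>\<alpha> | multi_degree \<alpha> < m. a s \<alpha> * multi_power (\<lambda>i. complex_of_real (x $ i)) \<alpha>)"
    by metis
  have "(\<Sum>s\<in>S. w s * q s x) = (\<Sum>\<alpha> | multi_degree \<alpha> < m. (\<Sum>s\<in>S. w s * a s \<alpha>)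
      * multi_power (\<lambda>i. complex_of_real (x $ i)) \<alpha>)" for x
    unfolding sum_distrib_right
    by (subst sum.swap) (simp add: a sum_distrib_left mult.assoc)
  then show ?thesis unfolding polys_of_degree_less_def by (auto intro: exI)
qed

text \<open>
  Multiplication by the coordinate \<open>x $ j\<close> shifts the exponent \<open>\<alpha> j\<close> up by one, so the new
  coefficients are the old ones read at the index shifted down, and zero where \<open>\<alpha> j = 0\<close>.
\<close>

lemma polys_of_degree_less_coordinate_mult:
  fixes q :: "real^'n \<Rightarrow> complex"
  assumes "q \<in> polys_of_degree_less m"
  shows "(\<lambda>x. complex_of_real (x $ j) * q x) \<in> polys_of_degree_less (Suc m)"
proof -
  obtain a where a: "\<And>x. q x =
      (\<Sum>\<alpha> | multi_degree \<alpha> < m. a \<alpha> * multi_power (\<lambda>i. complex_of_real (x $ i)) \<alpha>)"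
    using assms unfolding polys_of_degree_less_def by blast
  define up where "up \<alpha> = \<alpha>(j := Suc (\<alpha> j))" for \<alpha> :: "'n \<Rightarrow> nat"
  define down where "down \<alpha> = \<alpha>(j := \<alpha> j - 1)" for \<alpha> :: "'n \<Rightarrow> nat"
  have down_up: "down (up \<alpha>) = \<alpha>" for \<alpha> :: "'n \<Rightarrow> nat"
    by (auto simp: up_def down_def)
  have up_down: "up (down \<alpha>) = \<alpha>" if "\<alpha> j \<noteq> 0" for \<alpha> :: "'n \<Rightarrow> nat"
    using that by (auto simp: up_def down_def)
  have deg_up: "multi_degree (up \<alpha>) = Suc (multi_degree \<alpha>)" for \<alpha> :: "'n \<Rightarrow> nat"
    unfolding multi_degree_def
    by (subst (1 2) sum.remove[of UNIV j]) (auto simp: up_def intro: sum.cong)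
  have pow_up: "multi_power v (up \<alpha>) = v j * multi_power v \<alpha>" for v and \<alpha> :: "'n \<Rightarrow> nat"
    unfolding multi_power_def
    by (subst (1 2) prod.remove[of UNIV j]) (auto simp: up_def intro: prod.cong)
  have "complex_of_real (x $ j) * q x = (\<Sum>\<alpha> | multi_degree \<alpha> < Suc m.
      (if \<alpha> j = 0 then 0 else a (down \<alpha>)) * multi_power (\<lambda>i. complex_of_real (x $ i)) \<alpha>)" for x
  proof -
    have "complex_of_real (x $ j) * q x = (\<Sum>\<alpha> | multi_degree \<alpha> < m.
        a \<alpha> * multi_power (\<lambda>i. complex_of_real (x $ i)) (up \<alpha>))"
      by (simp add: a pow_up sum_distrib_left algebra_simps)
    also have "\<dots> = (\<Sum>\<alpha> | multi_degree \<alpha> < Suc m \<and> \<alpha> j \<noteq> 0.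
        a (down \<alpha>) * multi_power (\<lambda>i. complex_of_real (x $ i)) \<alpha>)"
    proof (rule sum.reindex_bij_witness[of _ down up])
      fix \<alpha> :: "'n \<Rightarrow> nat" assume *: "\<alpha> \<in> {\<alpha>. multi_degree \<alpha> < Suc m \<and> \<alpha> j \<noteq> 0}"
      then show "up (down \<alpha>) = \<alpha>" by (simp add: up_down)
      show "down \<alpha> \<in> {\<alpha>. multi_degree \<alpha> < m}" using * deg_up[of "down \<alpha>"] by (simp add: up_down)
    next
      fix \<alpha> :: "'n \<Rightarrow> nat" assume "\<alpha> \<in> {\<alpha>. multi_degree \<alpha> < m}"
      then show "up \<alpha> \<in> {\<alpha>. multi_degree \<alpha> < Suc m \<and> \<alpha> j \<noteq> 0}" by (simp add: deg_up) (simp add: up_def)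
    qed (simp_all add: down_up)
    also have "\<dots> = (\<Sum>\<alpha> | multi_degree \<alpha> < Suc m.
        (if \<alpha> j = 0 then 0 else a (down \<alpha>)) * multi_power (\<lambda>i. complex_of_real (x $ i)) \<alpha>)"
      by (intro sum.mono_neutral_cong_left finite_multi_degree_less) auto
    finally show ?thesis .
  qed
  then show ?thesis
    unfolding polys_of_degree_less_def
    by (intro CollectI exI[of _ "\<lambda>\<alpha>. if \<alpha> j = 0 then 0 else a (down \<alpha>)"]) blast
qed

lemma polys_of_degree_less_linear_form_mult:
  assumes "q \<in> polys_of_degree_less m"
  shows "(\<lambda>x. linear_form u x * q x) \<in> polys_of_degree_less (Suc m)"
  using polys_of_degree_less_sum[OF finite polys_of_degree_less_coordinate_mult[OF assms], of u]
  by (simp add: linear_form_def sum_distrib_right mult.assoc)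

lemma polys_of_degree_less_linear_form_power:
  assumes "q \<in> polys_of_degree_less m"
  shows "(\<lambda>x. linear_form u x ^ n * q x) \<in> polys_of_degree_less (m + n)"
proof (induction n)
  case 0
  then show ?case using assms by simp
next
  case (Suc n)
  then show ?case using polys_of_degree_less_linear_form_mult[OF Suc.IH, of u] by (simp add: mult.assoc)
qed

lemma one_in_polys_of_degree_less: "(\<lambda>x :: real^'n. 1) \<in> polys_of_degree_less (Suc 0)"
proof -
  have "{\<alpha> :: 'n \<Rightarrow> nat. multi_degree \<alpha> < Suc 0} = {\<lambda>_. 0}" by (auto simp: multi_degree_def)
  then show ?thesis
    unfolding polys_of_degree_less_def
    by (intro CollectI exI[of _ "\<lambda>_. 1"]) (simp add: multi_power_def)
qed

lemma linear_form_monomial_in_polys_of_degree_less: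
  fixes u :: "'n::finite \<Rightarrow> 'n \<Rightarrow> complex"
  shows "(\<lambda>x. multi_power (\<lambda>i. linear_form (u i) x) \<alpha>) \<in> polys_of_degree_less (Suc (multi_degree \<alpha>))"
proof -
  have "(\<lambda>x. \<Prod>i\<in>S. linear_form (u i) x ^ \<alpha> i) \<in> polys_of_degree_less (Suc (\<Sum>i\<in>S. \<alpha> i))"
    if "finite S" for S :: "'n set"
    using that
  proof (induction S rule: finite_induct)
    case empty
    then show ?case using one_in_polys_of_degree_less by simp
  next
    case (insert i S)
    then show ?case
      using polys_of_degree_less_linear_form_power[OF insert.IH, of "u i" "\<alpha> i"] by (simp add: add.commute)
  qed
  then show ?thesis by (simp add: multi_power_def multi_degree_def)
qed

text \<open>
  The eigenfunction is the product of the forms \<open>linear_form (u i)\<close> to the powers \<open>\<alpha> i\<close>, with one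
  left eigenvector \<open>u i\<close> chosen for each \<open>ev i\<close>. It is nonzero because finitely many null sets do not cover the space.
\<close>

lemma polynomial_eigenfunction_exists:
  fixes A :: "real^'n^'n"
  assumes "eigenvalues_with_multiplicity A ev"
  shows "\<exists>f \<in> polys_of_degree_less (Suc (multi_degree \<alpha>)).
    (\<exists>x. f x \<noteq> 0) \<and> (\<forall>x. f (A *v x) = multi_power ev \<alpha> * f x)"
proof -
  obtain u where nz: "\<And>k. \<exists>j. u k j \<noteq> 0"
    and left: "\<And>k j. (\<Sum>i\<in>UNIV. u k i * complex_of_real (A $ i $ j)) = ev k * u k j"
    using left_eigenvector_exists[OF assms] by metis
  define f where "f x = multi_power (\<lambda>i. linear_form (u i) x) \<alpha>" for x
  have "negligible (\<Union>k. {x. linear_form (u k) x = 0})"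
  proof (rule negligible_Union)
    show "finite (range (\<lambda>k. {x. linear_form (u k) x = 0}))" by simp
    fix Z assume "Z \<in> range (\<lambda>k. {x. linear_form (u k) x = 0})"
    then obtain k where "Z = {x. linear_form (u k) x = 0}" by blast
    moreover obtain j where "u k j \<noteq> 0" using nz by blast
    ultimately show "negligible Z" using linear_form_zeros_negligible by simp
  qed
  then have "(\<Union>k. {x. linear_form (u k) x = 0}) \<noteq> UNIV" by (metis non_negligible_UNIV)
  then obtain x where "\<And>k. linear_form (u k) x \<noteq> 0" by blast
  then have "f x \<noteq> 0" by (simp add: f_def multi_power_def)
  moreover have "f (A *v x) = multi_power ev \<alpha> * f x" for x
    by (simp add: f_def multi_power_def linear_form_left_eigenvector[OF left]
        power_mult_distrib prod.distrib)
  moreover have "f \<in> polys_of_degree_less (Suc (multi_degree \<alpha>))"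
    unfolding f_def by (rule linear_form_monomial_in_polys_of_degree_less)
  ultimately show ?thesis by blast
qed


section \<open>Sums over the lattice\<close>

lemma lattice_zero: "is_lattice \<Gamma> \<Longrightarrow> 0 \<in> \<Gamma>"
  unfolding is_lattice_def by (force intro: image_eqI[of _ _ 0])

lemma lattice_diff:
  fixes \<Gamma> :: "(real^'n) set"
  assumes "is_lattice \<Gamma>" "a \<in> \<Gamma>" "b \<in> \<Gamma>"
  shows "a - b \<in> \<Gamma>"
proof -
  obtain M :: "real^'n^'n" where M: "\<Gamma> = (\<lambda>z. M *v z) ` {z. \<forall>i. z $ i \<in> \<int>}"
    using assms(1) unfolding is_lattice_def by blast
  obtain y z where "a = M *v y" "b = M *v z" "\<forall>i. y $ i \<in> \<int>" "\<forall>i. z $ i \<in> \<int>"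
    using assms(2,3) unfolding M by blast
  then show ?thesis unfolding M
    by (intro image_eqI[of _ _ "y - z"]) (auto simp: matrix_vector_mult_diff_distrib)
qed

lemma finite_integer_vectors_bounded:
  fixes S :: "(real^'n) set"
  assumes "bounded S"
  shows "finite {z \<in> S. \<forall>i. z $ i \<in> \<int>}"
proof -
  obtain B where B: "\<And>z. z \<in> S \<Longrightarrow> norm z \<le> B" using assms unfolding bounded_iff by blast
  let ?F = "{t :: real. t \<in> \<int> \<and> \<bar>t\<bar> \<le> B}"
  have "{z \<in> S. \<forall>i. z $ i \<in> \<int>} \<subseteq> (\<lambda>g. \<chi> i. g i) ` (UNIV \<rightarrow>\<^sub>E ?F)"
  proof
    fix z assume z: "z \<in> {z \<in> S. \<forall>i. z $ i \<in> \<int>}"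
    then have "\<bar>z $ i\<bar> \<le> B" for i using B[of z] component_le_norm_cart[of z i] by simp
    then show "z \<in> (\<lambda>g. \<chi> i. g i) ` (UNIV \<rightarrow>\<^sub>E ?F)"
      using z by (intro image_eqI[of _ _ "\<lambda>i. z $ i"]) auto
  qed
  moreover have "finite (UNIV \<rightarrow>\<^sub>E ?F :: ('n \<Rightarrow> real) set)"
    using finite_abs_int_segment[of B] by (intro finite_PiE) auto
  ultimately show ?thesis by (meson finite_imageI finite_subset)
qed

lemma finite_lattice_bounded:
  fixes \<Gamma> :: "(real^'n) set"
  assumes "is_lattice \<Gamma>" "bounded S"
  shows "finite (\<Gamma> \<inter> S)"
proof -
  obtain M :: "real^'n^'n" where M: "invertible M" "\<Gamma> = (\<lambda>z. M *v z) ` {z. \<forall>i. z $ i \<in> \<int>}"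
    using assms(1) unfolding is_lattice_def by blast
  have inv: "matrix_inv M *v (M *v z) = z" for z
    using M(1) by (rule matrix_inv_cancel_left)
  let ?T = "(\<lambda>x. matrix_inv M *v x) ` S"
  have "bounded ?T" using assms(2) by (intro bounded_linear_image) auto
  then have "finite {z \<in> ?T. \<forall>i. z $ i \<in> \<int>}" by (rule finite_integer_vectors_bounded)
  moreover have "\<Gamma> \<inter> S \<subseteq> (\<lambda>z. M *v z) ` {z \<in> ?T. \<forall>i. z $ i \<in> \<int>}"
  proof
    fix k assume k: "k \<in> \<Gamma> \<inter> S"
    then obtain z where z: "k = M *v z" "\<forall>i. z $ i \<in> \<int>" unfolding M by blast
    then have "z \<in> ?T" using k inv[of z] by (intro image_eqI[of _ _ k]) auto
    then show "k \<in> (\<lambda>z. M *v z) ` {z \<in> ?T. \<forall>i. z $ i \<in> \<int>}" using z by blast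
  qed
  ultimately show ?thesis by (meson finite_imageI finite_subset)
qed

lemma finite_active_translates:
  assumes "is_lattice \<Gamma>" "compactly_supported \<phi>"
  shows "finite {k \<in> \<Gamma>. \<phi> (x + k) \<noteq> 0}"
proof -
  let ?S = "(\<lambda>z. z - x) ` closure {x. \<phi> x \<noteq> 0}"
  have "compact ?S" using assms(2) unfolding compactly_supported_def
    by (intro compact_continuous_image continuous_intros)
  then have "finite (\<Gamma> \<inter> ?S)" using assms(1) by (intro finite_lattice_bounded compact_imp_bounded)
  moreover have "{k \<in> \<Gamma>. \<phi> (x + k) \<noteq> 0} \<subseteq> \<Gamma> \<inter> ?S"
  proof
    fix k assume k: "k \<in> {k \<in> \<Gamma>. \<phi> (x + k) \<noteq> 0}"
    then have "x + k \<in> closure {x. \<phi> x \<noteq> 0}"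
      using subsetD[OF closure_subset, of "x + k" "{x. \<phi> x \<noteq> 0}"] by simp
    then have "k \<in> ?S" by (rule rev_image_eqI) simp
    then show "k \<in> \<Gamma> \<inter> ?S" using k by simp
  qed
  ultimately show ?thesis using finite_subset by blast
qed

lemma has_sum_finite_active:
  fixes g :: "'a \<Rightarrow> complex"
  assumes "finite F" "F \<subseteq> \<Gamma>" "\<And>k. k \<in> \<Gamma> - F \<Longrightarrow> g k = 0"
  shows "(g has_sum s) \<Gamma> \<longleftrightarrow> s = (\<Sum>k\<in>F. g k)"
proof -
  have "(g has_sum s) \<Gamma> \<longleftrightarrow> (g has_sum s) F"
    using assms by (intro has_sum_cong_neutral) auto
  then show ?thesis
    using assms(1) using has_sum_finite[of F g] has_sum_unique by blast
qed

text \<open>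
  The shift space is written with \<open>\<phi> (x + k)\<close> and independence with \<open>\<phi> (x - k)\<close>; the
  symmetry \<open>\<Gamma> = - \<Gamma>\<close> translates between them.
\<close>

lemma independent_translates_plus:
  assumes "is_lattice \<Gamma>" "independent_translates \<Gamma> \<phi>"
    and zero: "\<And>x. ((\<lambda>m. a m * \<phi> (x + m)) has_sum 0) \<Gamma>" and "m \<in> \<Gamma>"
  shows "a m = 0"
proof -
  have neg: "- k \<in> \<Gamma>" if "k \<in> \<Gamma>" for k
    using lattice_diff[OF assms(1) lattice_zero[OF assms(1)] that] by simp
  have "bij_betw uminus \<Gamma> \<Gamma>" by (rule bij_betwI[of _ _ _ uminus]) (auto simp: neg)
  then have "((\<lambda>k. a (- k) * \<phi> (x - k)) has_sum 0) \<Gamma>" for x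
    using has_sum_reindex_bij_betw[of uminus \<Gamma> \<Gamma> "\<lambda>m. a m * \<phi> (x + m)" 0] zero[of x] by simp
  then have "\<forall>k\<in>\<Gamma>. a (- k) = 0"
    using assms(2) unfolding independent_translates_def by (elim allE[of _ "\<lambda>k. a (- k)"]) blast
  then show ?thesis using neg[OF assms(4)] by force
qed


section \<open>The subdivision operator\<close>

text \<open>
  The row indices at which column \<open>m\<close> of \<open>[c (A k - m)]\<close> can be nonzero.
\<close>

definition subdivision_sources ::
    "(real^'n) set \<Rightarrow> real^'n^'n \<Rightarrow> (real^'n) set \<Rightarrow> real^'n \<Rightarrow> (real^'n) set" where
  "subdivision_sources \<Gamma> A \<Lambda> m = {k \<in> \<Gamma>. A *v k - m \<in> \<Lambda>}"

lemma finite_subdivision_sources: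
  assumes "invertible A" "finite \<Lambda>"
  shows "finite (subdivision_sources \<Gamma> A \<Lambda> m)"
proof -
  have "subdivision_sources \<Gamma> A \<Lambda> m \<subseteq> (\<lambda>l. matrix_inv A *v (l + m)) ` \<Lambda>"
  proof
    fix k assume "k \<in> subdivision_sources \<Gamma> A \<Lambda> m"
    then show "k \<in> (\<lambda>l. matrix_inv A *v (l + m)) ` \<Lambda>"
      using assms(1) unfolding subdivision_sources_def
      by (intro image_eqI[of _ _ "A *v k - m"])
        (auto simp: matrix_inv_cancel_left)
  qed
  then show ?thesis using assms(2) by (meson finite_imageI finite_subset)
qed

lemma subdivision_sources_subset_w_map:
  assumes "invertible A" "m \<in> \<Omega>"
  shows "subdivision_sources \<Gamma> A \<Lambda> m \<subseteq> w_map A \<Lambda> \<Omega> \<inter> \<Gamma>"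
proof
  fix k assume k: "k \<in> subdivision_sources \<Gamma> A \<Lambda> m"
  have "k = matrix_inv A *v (m + (A *v k - m))"
    using assms(1) by (simp add: matrix_inv_cancel_left)
  then show "k \<in> w_map A \<Lambda> \<Omega> \<inter> \<Gamma>"
    using k assms(2) unfolding subdivision_sources_def w_map_def by blast
qed

text \<open>
  The row vector \<open>y\<close> times the infinite matrix \<open>[c (A k - m)]\<close>. The sum runs over the finite
  set of possibly nonzero entries of a column, so it is meaningful for every sequence \<open>y\<close>.
\<close>

definition subdivision ::
    "(real^'n) set \<Rightarrow> real^'n^'n \<Rightarrow> (real^'n) set \<Rightarrow> (real^'n \<Rightarrow> complex)
      \<Rightarrow> (real^'n \<Rightarrow> complex) \<Rightarrow> real^'n \<Rightarrow> complex" where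
  "subdivision \<Gamma> A \<Lambda> c y m = (\<Sum>k\<in>subdivision_sources \<Gamma> A \<Lambda> m. y k * c (A *v k - m))"

text \<open>
  The refinement equation rewrites an expansion in the translates of \<open>\<phi>\<close> as an expansion in
  those of \<open>\<phi> \<circ> A\<close>. At a fixed point \<open>x\<close> both sums are finite: \<open>G\<close> holds the translates of
  \<open>\<phi>\<close> that are active at \<open>A x\<close>, and \<open>S\<close> all indices \<open>k\<close> that can contribute to them.
\<close>

lemma has_sum_subdivision:
  assumes lat: "is_lattice \<Gamma>" and A: "invertible A" "(\<lambda>x. A *v x) ` \<Gamma> \<subseteq> \<Gamma>"
    and L: "\<Lambda> \<subseteq> \<Gamma>" "finite \<Lambda>" and c: "\<forall>k\<in>\<Gamma> - \<Lambda>. c k = 0"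
    and cs: "compactly_supported \<phi>" and ref: "refinable A \<Lambda> c \<phi>"
    and f: "((\<lambda>k. y k * \<phi> (x + k)) has_sum s) \<Gamma>"
  shows "((\<lambda>m. subdivision \<Gamma> A \<Lambda> c y m * \<phi> (A *v x + m)) has_sum s) \<Gamma>"
proof -
  define G where "G = {m \<in> \<Gamma>. \<phi> (A *v x + m) \<noteq> 0}"
  define S where "S = (\<Union>m\<in>G. subdivision_sources \<Gamma> A \<Lambda> m)"
  have G: "finite G" unfolding G_def using lat cs by (rule finite_active_translates)
  have S: "finite S" "S \<subseteq> \<Gamma>"
    using G finite_subdivision_sources[OF A(1) L(2)] by (auto simp: S_def subdivision_sources_def)
  have diff: "A *v k - l \<in> \<Gamma>" if "k \<in> \<Gamma>" "l \<in> \<Gamma>" for k l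
    using A(2) that lat lattice_diff by blast
  \<comment> \<open>The refinement equation at \<open>x + k\<close>, with \<open>l\<close> replaced by \<open>m = A k - l\<close>.\<close>
  have refine: "\<phi> (x + k) = (\<Sum>m\<in>G. c (A *v k - m) * \<phi> (A *v x + m))" if "k \<in> \<Gamma>" for k
  proof -
    have "\<phi> (x + k) = (\<Sum>l\<in>\<Lambda>. c l * \<phi> (A *v x + (A *v k - l)))"
      using ref[unfolded refinable_def, rule_format, of "x + k"]
      by (simp only: matrix_vector_right_distrib add_diff_eq)
    also have "\<dots> = (\<Sum>l\<in>{l\<in>\<Lambda>. A *v k - l \<in> G}. c l * \<phi> (A *v x + (A *v k - l)))"
      using L diff[OF that] by (intro sum.mono_neutral_right) (auto simp: G_def)
    also have "\<dots> = (\<Sum>m\<in>{m\<in>G. A *v k - m \<in> \<Lambda>}. c (A *v k - m) * \<phi> (A *v x + m))"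
      by (rule sum.reindex_bij_witness[of _ "\<lambda>m. A *v k - m" "\<lambda>l. A *v k - l"]) auto
    also have "\<dots> = (\<Sum>m\<in>G. c (A *v k - m) * \<phi> (A *v x + m))"
    proof (intro sum.mono_neutral_left G ballI)
      fix m assume m: "m \<in> G - {m \<in> G. A *v k - m \<in> \<Lambda>}"
      then have "A *v k - m \<in> \<Gamma> - \<Lambda>" using diff[OF that, of m] by (auto simp: G_def)
      then show "c (A *v k - m) * \<phi> (A *v x + m) = 0" using c by simp
    qed auto
    finally show ?thesis .
  qed
  have "y k * \<phi> (x + k) = 0" if k: "k \<in> \<Gamma> - S" for k
  proof -
    have "c (A *v k - m) = 0" if "m \<in> G" for m
    proof -
      have "A *v k - m \<notin> \<Lambda>" using k that by (auto simp: S_def subdivision_sources_def)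
      then show ?thesis using c diff[of k m] k that by (auto simp: G_def)
    qed
    then show ?thesis using k refine by simp
  qed
  then have "s = (\<Sum>k\<in>S. y k * \<phi> (x + k))"
    using f has_sum_finite_active[OF S, of "\<lambda>k. y k * \<phi> (x + k)" s] by simp
  also have "\<dots> = (\<Sum>k\<in>S. \<Sum>m\<in>G. y k * c (A *v k - m) * \<phi> (A *v x + m))"
    using S by (intro sum.cong) (auto simp: refine sum_distrib_left mult.assoc)
  also have "\<dots> = (\<Sum>m\<in>G. (\<Sum>k\<in>S. y k * c (A *v k - m)) * \<phi> (A *v x + m))"
    by (subst sum.swap) (simp add: sum_distrib_right)
  also have "\<dots> = (\<Sum>m\<in>G. subdivision \<Gamma> A \<Lambda> c y m * \<phi> (A *v x + m))"
  proof (intro sum.cong refl arg_cong2[where f = "(*)"])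
    fix m assume m: "m \<in> G"
    show "(\<Sum>k\<in>S. y k * c (A *v k - m)) = subdivision \<Gamma> A \<Lambda> c y m"
      unfolding subdivision_def
    proof (intro sum.mono_neutral_right S ballI)
      show "subdivision_sources \<Gamma> A \<Lambda> m \<subseteq> S" using m by (auto simp: S_def)
      fix k assume "k \<in> S - subdivision_sources \<Gamma> A \<Lambda> m"
      then have "A *v k - m \<in> \<Gamma> - \<Lambda>" using diff[of k m] m S
        by (auto simp: subdivision_sources_def G_def)
      then show "y k * c (A *v k - m) = 0" using c by simp
    qed
  qed
  finally show ?thesis by (subst has_sum_finite_active[of G]) (use G in \<open>auto simp: G_def\<close>)
qed

text \<open>
  At \<open>z = A x\<close> the values \<open>f z\<close> and \<open>\<nu> * f x\<close> agree; the first is the expansion with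
  coefficients \<open>y\<close>, the second the one with coefficients \<open>\<nu> * subdivision \<Gamma> A \<Lambda> c y\<close>, and
  every point \<open>z\<close> has this form. Independence then identifies the coefficients.
\<close>

lemma subdivision_eigensequence:
  assumes lat: "is_lattice \<Gamma>" and A: "invertible A" "(\<lambda>x. A *v x) ` \<Gamma> \<subseteq> \<Gamma>"
    and L: "\<Lambda> \<subseteq> \<Gamma>" "finite \<Lambda>" and c: "\<forall>k\<in>\<Gamma> - \<Lambda>. c k = 0"
    and cs: "compactly_supported \<phi>" and ref: "refinable A \<Lambda> c \<phi>"
    and ind: "independent_translates \<Gamma> \<phi>"
    and f: "\<And>x. ((\<lambda>k. y k * \<phi> (x + k)) has_sum f x) \<Gamma>"
    and hom: "\<And>x. f (A *v x) = \<nu> * f x" and m: "m \<in> \<Gamma>"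
  shows "y m = \<nu> * subdivision \<Gamma> A \<Lambda> c y m"
proof -
  have zero: "((\<lambda>m. (y m - \<nu> * subdivision \<Gamma> A \<Lambda> c y m) * \<phi> (z + m)) has_sum 0) \<Gamma>" for z
  proof -
    define x where "x = matrix_inv A *v z"
    have z: "A *v x = z" using A(1) by (simp add: x_def matrix_inv_cancel_right)
    have "((\<lambda>m. - \<nu> * (subdivision \<Gamma> A \<Lambda> c y m * \<phi> (A *v x + m))) has_sum - \<nu> * f x) \<Gamma>"
      by (rule has_sum_cmult_right[OF has_sum_subdivision[OF lat A L c cs ref f]])
    then have "((\<lambda>m. - \<nu> * (subdivision \<Gamma> A \<Lambda> c y m * \<phi> (z + m))) has_sum - f z) \<Gamma>"
      using hom[of x] by (simp only: z mult_minus_left)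
    from has_sum_add[OF f[of z] this] show ?thesis by (simp add: algebra_simps)
  qed
  show ?thesis
    using independent_translates_plus[where a = "\<lambda>m. y m - \<nu> * subdivision \<Gamma> A \<Lambda> c y m",
        OF lat ind zero m] by simp
qed

text \<open>
  Admissibility forces the nonzero entries of a column with index in \<open>\<Omega>\<close> to lie in rows of
  \<open>\<Omega>\<close>, so the infinite matrix acts on the columns in \<open>\<Omega>\<close> by its finite block.
\<close>

lemma subdivision_admissible:
  assumes "invertible A" "finite \<Omega>" "admissible \<Gamma> A \<Lambda> \<Omega>" and c: "\<forall>k\<in>\<Gamma> - \<Lambda>. c k = 0"
    and lat: "is_lattice \<Gamma>" "(\<lambda>x. A *v x) ` \<Gamma> \<subseteq> \<Gamma>" and m: "m \<in> \<Omega>"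
  shows "subdivision \<Gamma> A \<Lambda> c y m = (\<Sum>k\<in>\<Omega>. y k * c (A *v k - m))"
  unfolding subdivision_def
proof (intro sum.mono_neutral_left assms(2) ballI)
  have \<Omega>: "\<Omega> \<subseteq> \<Gamma>" "w_map A \<Lambda> \<Omega> \<inter> \<Gamma> \<subseteq> \<Omega>" using assms(3) by (auto simp: admissible_def)
  then show "subdivision_sources \<Gamma> A \<Lambda> m \<subseteq> \<Omega>"
    using subdivision_sources_subset_w_map[OF assms(1) m] by blast
  fix k assume k: "k \<in> \<Omega> - subdivision_sources \<Gamma> A \<Lambda> m"
  then have "A *v k - m \<in> \<Gamma>" using lat \<Omega> m lattice_diff by blast
  then have "A *v k - m \<in> \<Gamma> - \<Lambda>" using k \<Omega> by (auto simp: subdivision_sources_def)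
  then show "y k * c (A *v k - m) = 0" using c by simp
qed

text \<open>
  The eigenequation at \<open>m \<in> \<Omega> (Suc i)\<close> involves on its right-hand side only values of \<open>y\<close> on
  \<open>\<Omega> i\<close>, so zeros on \<open>\<Omega> 0\<close> would propagate through the whole lattice.
\<close>

lemma eigensequence_nonzero_on_first:
  assumes "invertible A" "\<And>i. w_map A \<Lambda> (\<Omega> (Suc i)) \<inter> \<Gamma> \<subseteq> \<Omega> i" "(\<Union>i. \<Omega> i) = \<Gamma>"
    and eig: "\<And>m. m \<in> \<Gamma> \<Longrightarrow> y m = \<nu> * subdivision \<Gamma> A \<Lambda> c y m"
    and "k \<in> \<Gamma>" "y k \<noteq> 0"
  shows "\<exists>p\<in>\<Omega> 0. y p \<noteq> 0"
proof (rule ccontr)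
  assume zero: "\<not> (\<exists>p\<in>\<Omega> 0. y p \<noteq> 0)"
  have "\<forall>m\<in>\<Omega> i. y m = 0" for i
  proof (induction i)
    case 0
    then show ?case using zero by blast
  next
    case (Suc i)
    show ?case
    proof
      fix m assume m: "m \<in> \<Omega> (Suc i)"
      have "subdivision_sources \<Gamma> A \<Lambda> m \<subseteq> \<Omega> i"
        using subdivision_sources_subset_w_map[OF assms(1) m] assms(2) by blast
      then have "subdivision \<Gamma> A \<Lambda> c y m = 0"
        unfolding subdivision_def using Suc by (intro sum.neutral) auto
      moreover have "m \<in> \<Gamma>" using m assms(3) by blast
      ultimately show "y m = 0" using eig by simp
    qed
  qed
  then show False using assms(3,5,6) by blast
qed


section \<open>Eigenvalues of the finite blocks\<close>

theorem corollary5p1: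
  fixes \<Gamma> \<Lambda> D \<Lambda>' \<Omega>' :: "(real^'n) set"
    and A :: "real^'n^'n"
    and c \<phi> :: "real^'n \<Rightarrow> complex"
    and \<Omega> :: "nat \<Rightarrow> (real^'n) set"
    and n0 \<kappa> :: nat
    and ev \<eta> :: "'n \<Rightarrow> complex"
  assumes "is_lattice \<Gamma>"
    and "dilation_matrix \<Gamma> A"
    and "\<Lambda> \<subseteq> \<Gamma>" and "finite \<Lambda>" and "\<Lambda> \<noteq> {}"
    and "\<forall>k\<in>\<Gamma> - \<Lambda>. c k = 0"
    and "compactly_supported \<phi>"
    and "refinable A \<Lambda> c \<phi>"
    and "full_representatives \<Gamma> A D" and "0 \<in> D"
    and "tiles_by \<Gamma> (attractor A D)"
    and "\<Lambda>' = minkowski_diff \<Lambda> D"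
    and "\<Omega>' = lattice_attractor \<Gamma> A \<Lambda>'"
    and "\<forall>i. finite (\<Omega> i) \<and> \<Omega> i \<subseteq> \<Gamma>"
    and "\<Omega> 0 = lattice_attractor \<Gamma> A \<Lambda>"
    and "\<forall>i. \<Omega> i \<subset> \<Omega> (Suc i)"
    and "(\<Union>i. \<Omega> i) = \<Gamma>"
    and "\<forall>i. admissible \<Gamma> A \<Lambda> (\<Omega> i)"
    and "\<forall>i. w_map A \<Lambda> (\<Omega> (Suc i)) \<inter> \<Gamma> \<subseteq> \<Omega> i"
    and "\<Omega> n0 = \<Omega>'"
    and "\<forall>i\<ge>n0. admissible \<Gamma> A \<Lambda>' (\<Omega> i)"
    and "\<forall>i\<ge>n0. w_map A \<Lambda>' (\<Omega> (Suc i)) \<inter> \<Gamma> \<subseteq> \<Omega> i"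
    and "has_accuracy \<Gamma> \<phi> \<kappa>"
    and "independent_translates \<Gamma> \<phi>"
    and "eigenvalues_with_multiplicity A ev"
    and "\<eta> = (\<lambda>i. 1 / ev i)"
  shows "\<forall>n. \<forall>s<\<kappa>. \<forall>\<alpha>. multi_degree \<alpha> = s \<longrightarrow>
           eigenvalue_on (\<Omega> n) (\<lambda>i j. c (A *v i - j)) (multi_power \<eta> \<alpha>)"
proof (intro allI impI)
  fix n s and \<alpha> :: "'n \<Rightarrow> nat"
  assume s: "s < \<kappa>" and \<alpha>: "multi_degree \<alpha> = s"
  note lat = assms(1) and L = assms(3,4) and c = assms(6) and cs = assms(7) and ref = assms(8)
    and ind = assms(24)
  have A: "invertible A" "(\<lambda>x. A *v x) ` \<Gamma> \<subseteq> \<Gamma>"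
    using dilation_matrix_invertible[OF assms(2)] assms(2) by (auto simp: dilation_matrix_def)
  obtain f where f: "f \<in> polys_of_degree_less (Suc s)" "\<exists>x. f x \<noteq> 0"
    and hom: "\<And>x. f (A *v x) = multi_power ev \<alpha> * f x"
    using polynomial_eigenfunction_exists[OF assms(25), of \<alpha>] \<alpha> by blast
  have "f \<in> shift_space \<Gamma> \<phi>"
    using f(1) polys_of_degree_less_mono[of "Suc s" \<kappa>] s assms(23)
    unfolding has_accuracy_def by (meson Suc_leI subsetD)
  then obtain y where y: "\<And>x. ((\<lambda>k. y k * \<phi> (x + k)) has_sum f x) \<Gamma>"
    unfolding shift_space_def by blast
  have eig: "y m = multi_power ev \<alpha> * subdivision \<Gamma> A \<Lambda> c y m" if "m \<in> \<Gamma>" for m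
    by (rule subdivision_eigensequence[where f = f and \<nu> = "multi_power ev \<alpha>",
          OF lat A L c cs ref ind y hom that])
  have "\<exists>k\<in>\<Gamma>. y k \<noteq> 0"
  proof (rule ccontr)
    assume "\<not> (\<exists>k\<in>\<Gamma>. y k \<noteq> 0)"
    then have "f x = 0" for x
      using y[of x] has_sum_finite_active[of "{}" \<Gamma> "\<lambda>k. y k * \<phi> (x + k)" "f x"] by simp
    then show False using f(2) by blast
  qed
  then obtain p where p: "p \<in> \<Omega> 0" "y p \<noteq> 0"
    using eigensequence_nonzero_on_first[of A \<Lambda> \<Omega> \<Gamma> y, OF A(1) _ assms(17) eig] assms(19) by blast
  have ev: "multi_power ev \<alpha> \<noteq> 0" using eig[OF subsetD[of "\<Omega> 0" \<Gamma> p]] p assms(14) by auto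
  have \<eta>: "multi_power \<eta> \<alpha> = 1 / multi_power ev \<alpha>"
    by (simp add: assms(26) multi_power_def power_divide prod_dividef)
  show "eigenvalue_on (\<Omega> n) (\<lambda>i j. c (A *v i - j)) (multi_power \<eta> \<alpha>)"
  proof (rule eigenvalue_on_if_left_eigenvector)
    show "finite (\<Omega> n)" using assms(14) by blast
    show "p \<in> \<Omega> n" using p lift_Suc_mono_le[of \<Omega> 0 n] assms(16) by blast
    fix j assume j: "j \<in> \<Omega> n"
    have "(\<Sum>i\<in>\<Omega> n. y i * c (A *v i - j)) = subdivision \<Gamma> A \<Lambda> c y j"
      using assms(14,18) by (intro subdivision_admissible[OF A(1) _ _ c lat A(2) j, symmetric]) auto
    then show "(\<Sum>i\<in>\<Omega> n. y i * c (A *v i - j)) = multi_power \<eta> \<alpha> * y j"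
      using eig[OF subsetD[of "\<Omega> n" \<Gamma> j]] ev j assms(14) by (auto simp: \<eta>)
  qed (rule p)
qed

end
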